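(* Let $X$ be a Banach space. Assume that there is a linear topology $\tau$ on $X$ satisfying the following two conditions: (i) Any bounded sequence in $X$ admits a $\tau$-convergent subsequence. (ii) If $(x_n)$ is a bounded sequence $\tau$-converging to $0$, then $$\forall y\in X:\quad \limsup\|x_n+y\|=\|y\|+\limsup\|x_n\|.$$ Then $X$ has both the $1$-Schur property and the $1$-strong Schur property.
   Context: $X$ is a Banach space over $\mathbb F\in\{\mathbb R,\mathbb C\}$. A linear topology is a topology making addition and scalar multiplication continuous; bounded means norm-bounded. For a bounded sequence put $\operatorname{ca}(x_n)=\inf_{n}\operatorname{diam}\{x_k: k\ge n\}$ (also for scalar sequences) and $\delta(x_n)=\sup\{\operatorname{ca}(x^*(x_n)): x^*\in B_{X^*}\}$. $X$ has the $1$-Schur property if $\operatorname{ca}(x_n)\le\delta(x_n)$ for each bounded sequence $(x_n)$ in $X$. $X$ has the $1$-strong Schur property if for any $\delta\in(0,2]$, any $\varepsilon>0$ and any normalized $\delta$-separated sequence in $X$ (i.e. $\|x_n\|=1$ and $\|x_n-x_m\|\ge\delta$ for $n\neq m$) there is a subsequence which is $(\frac2\delta+\varepsilon)$-equivalent to the standard basis of $\ell_1$; a normalized sequence $(y_j)$ is $K$-equivalent to the standard basis of $\ell_1$ if $\frac1K\sum_{j=1}^m|\alpha_j|\le\|\sum_{j=1}^m\alpha_jy_j\|$ for all $m$ and $\alpha_1,\dots,\alpha_m\in\mathbb F$. *)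

theory Defs
  imports "HOL-Analysis.Analysis"
begin

text \<open>
  The scalar fields: up to an isometric field isomorphism, a type of this class is
  either the field of real numbers or the field of complex numbers.
\<close>

class real_or_complex = real_normed_field +
  assumes iso_real_or_complex:
    "(\<exists>h :: 'a \<Rightarrow> real. bij h \<and> (\<forall>a b. h (a + b) = h a + h b) \<and>
        (\<forall>a b. h (a * b) = h a * h b) \<and> (\<forall>a. norm (h a) = norm a)) \<or>
     (\<exists>h :: 'a \<Rightarrow> complex. bij h \<and> (\<forall>a b. h (a + b) = h a + h b) \<and>
        (\<forall>a b. h (a * b) = h a * h b) \<and> (\<forall>a. norm (h a) = norm a))"

instance real :: real_or_complex
  by standard (rule disjI1, rule exI[of _ id], simp)

instance complex :: real_or_complex
  by standard (rule disjI2, rule exI[of _ id], simp)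

text \<open>
  The class \<^class>\<open>banach\<close> only provides real scalar multiplication; the scalar
  multiplication of the field under consideration is an explicit parameter extending it.
\<close>

locale banach_space_over = vector_space smul
  for smul :: "'k::real_or_complex \<Rightarrow> 'a::banach \<Rightarrow> 'a" +
  assumes norm_smul: "norm (smul c x) = norm c * norm x"
    and smul_of_real: "smul (of_real r) x = r *\<^sub>R x"

lemma banach_space_over_scaleR: "banach_space_over (scaleR :: real \<Rightarrow> 'a::banach \<Rightarrow> 'a)"
  by unfold_locales (auto simp: algebra_simps)

lemma banach_space_over_complex: "banach_space_over ((*) :: complex \<Rightarrow> complex \<Rightarrow> complex)"
  by unfold_locales (auto simp: algebra_simps norm_mult scaleR_conv_of_real)

text \<open>No separation axiom is imposed.\<close>

definition linear_topology ::
    "('k::real_or_complex \<Rightarrow> 'a::banach \<Rightarrow> 'a) \<Rightarrow> 'a topology \<Rightarrow> bool" where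
  "linear_topology smul \<tau> \<longleftrightarrow>
     topspace \<tau> = UNIV \<and>
     continuous_map (prod_topology \<tau> \<tau>) \<tau> (\<lambda>(x, y). x + y) \<and>
     continuous_map (prod_topology euclidean \<tau>) \<tau> (\<lambda>(c, x). smul c x)"

definition dual_unit_ball ::
    "('k::real_or_complex \<Rightarrow> 'a::banach \<Rightarrow> 'a) \<Rightarrow> ('a \<Rightarrow> 'k) set" where
  "dual_unit_ball smul =
     {f. Vector_Spaces.linear smul (*) f \<and> bounded_linear f \<and> onorm f \<le> 1}"

text \<open>
  Both quantities below are meant for bounded sequences only: there the infimum and the
  supremum are taken over nonempty sets that are bounded in the relevant direction.
\<close>

definition ca :: "(nat \<Rightarrow> 'b::metric_space) \<Rightarrow> real" where
  "ca x = (INF n. diameter {x k |k. k \<ge> n})"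

definition weak_ca ::
    "('k::real_or_complex \<Rightarrow> 'a::banach \<Rightarrow> 'a) \<Rightarrow> (nat \<Rightarrow> 'a) \<Rightarrow> real" where
  "weak_ca smul x = (SUP f\<in>dual_unit_ball smul. ca (\<lambda>n. f (x n)))"

definition one_Schur :: "('k::real_or_complex \<Rightarrow> 'a::banach \<Rightarrow> 'a) \<Rightarrow> bool" where
  "one_Schur smul \<longleftrightarrow> (\<forall>x. bounded (range x) \<longrightarrow> ca x \<le> weak_ca smul x)"

definition equiv_l1_basis ::
    "('k::real_or_complex \<Rightarrow> 'a::banach \<Rightarrow> 'a) \<Rightarrow> real \<Rightarrow> (nat \<Rightarrow> 'a) \<Rightarrow> bool" where
  "equiv_l1_basis smul K y \<longleftrightarrow>
     (\<forall>j. norm (y j) = 1) \<and>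
     (\<forall>m (\<alpha> :: nat \<Rightarrow> 'k).
        1 / K * (\<Sum>j<m. norm (\<alpha> j)) \<le> norm (\<Sum>j<m. smul (\<alpha> j) (y j)))"

definition one_strong_Schur :: "('k::real_or_complex \<Rightarrow> 'a::banach \<Rightarrow> 'a) \<Rightarrow> bool" where
  "one_strong_Schur smul \<longleftrightarrow>
     (\<forall>\<delta> \<epsilon> x. 0 < \<delta> \<and> \<delta> \<le> 2 \<and> 0 < \<epsilon> \<and>
        (\<forall>n. norm (x n) = 1) \<and> (\<forall>n m. n \<noteq> m \<longrightarrow> norm (x n - x m) \<ge> \<delta>) \<longrightarrow>
        (\<exists>r. strict_mono (r :: nat \<Rightarrow> nat) \<and> equiv_l1_basis smul (2 / \<delta> + \<epsilon>) (x \<circ> r)))"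

end

theory Submission
  imports Defs
begin

text \<open>
  Call a bounded sequence \<open>x\<close> asymptotically additive around \<open>l\<close> with radius \<open>\<rho>\<close> if
  \<open>\<parallel>x n - l + u\<parallel>\<close> tends to \<open>\<parallel>u\<parallel> + \<rho>\<close> for every vector \<open>u\<close>. The two hypotheses on the linear
  topology say that every bounded sequence has such a subsequence
  (\<open>subseq_asymptotically_additive\<close>): take \<open>l\<close> to be a limit of a convergent subsequence, thin it
  out until \<open>\<parallel>x n - l\<parallel>\<close> converges, and use that the assumed limes superior formula holds along all
  further subsequences. The topology plays no role afterwards.

  The limit is uniform for \<open>u\<close> in a compact set and for coefficients of modulus at most 1, so a
  subsequence can be chosen inductively, with summable errors, for which
  \<open>\<parallel>\<Sum> \<alpha>\<^sub>j x\<^sub>j\<parallel> \<ge> \<bar>\<Sum> \<alpha>\<^sub>j\<bar> \<parallel>l\<parallel> + (\<rho> - \<eta>) \<Sum> \<bar>\<alpha>\<^sub>j\<bar>\<close> with \<open>\<eta> > 0\<close> as small as desired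
  (\<open>subseq_norm_sum_ge\<close>). Both properties follow from this estimate.

  Strong Schur: if the sequence is \<open>\<delta>\<close>-separated, letting first one and then the other index of
  \<open>\<parallel>x m - x n\<parallel>\<close> tend to infinity gives \<open>\<delta> \<le> 2 \<rho>\<close>, and the last term of the estimate is the
  required lower bound.

  Schur: for \<open>0 < c < ca x\<close> choose differences \<open>d\<close> of far-out terms of \<open>x\<close> of norm more than \<open>c'\<close>
  for some \<open>c'\<close> above \<open>c\<close>, asymptotically additive around \<open>l\<close> with radius \<open>\<rho>\<close>; then
  \<open>\<parallel>l\<parallel> + \<rho> \<ge> c'\<close>. Restricted to convex combinations, the estimate says that the convex hull of a
  subsequence of \<open>d\<close> stays outside the open ball of radius \<open>c\<close>. The Hahn--Banach theorem separates
  it from that ball by a functional of norm at most 1, which is at least \<open>c\<close> on that subsequence and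
  hence oscillates by at least \<open>c\<close> along \<open>x\<close>. The form of Hahn--Banach needed is derived here from
  Zorn's lemma applied to sublinear functionals, whose minimal elements are linear.
\<close>

section \<open>Sublinear functionals and separation of a convex set from a ball\<close>


text \<open>Subadditive and positively homogeneous real functions on a real vector space.\<close>
definition sublinear :: "('a::real_vector \<Rightarrow> real) \<Rightarrow> bool" where
  "sublinear p \<longleftrightarrow> (\<forall>x y. p (x + y) \<le> p x + p y) \<and> (\<forall>t x. 0 \<le> t \<longrightarrow> p (t *\<^sub>R x) = t * p x)"

lemma sublinear_add: "sublinear p \<Longrightarrow> p (x + y) \<le> p x + p y"
  and sublinear_scale: "sublinear p \<Longrightarrow> 0 \<le> t \<Longrightarrow> p (t *\<^sub>R x) = t * p x"
  by (auto simp: sublinear_def)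

lemma sublinear_zero: "sublinear p \<Longrightarrow> p 0 = 0"
  using sublinear_scale[of p 0 0] by simp

lemma sublinear_minus_ge: "sublinear p \<Longrightarrow> - p (- x) \<le> p x"
  using sublinear_add[of p x "- x"] sublinear_zero[of p] by simp

lemma sublinearI:
  assumes add: "\<And>x y. p (x + y) \<le> p x + p y"
    and scale: "\<And>t x. 0 < t \<Longrightarrow> p (t *\<^sub>R x) \<le> t * p x"
    and zero: "p 0 = 0"
  shows "sublinear p"
  unfolding sublinear_def
proof (intro conjI allI impI)
  fix t :: real and x
  assume "0 \<le> t"
  show "p (t *\<^sub>R x) = t * p x"
  proof (cases "t = 0")
    case True
    then show ?thesis by (simp add: zero)
  next
    case False
    with \<open>0 \<le> t\<close> have t: "0 < t" by simp
    have "t * p x = t * p ((1 / t) *\<^sub>R (t *\<^sub>R x))"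
      using t by simp
    also have "\<dots> \<le> t * ((1 / t) * p (t *\<^sub>R x))"
      by (intro mult_left_mono scale) (use t in auto)
    also have "\<dots> = p (t *\<^sub>R x)"
      using t by simp
    finally show ?thesis
      using scale[OF t, of x] by linarith
  qed
qed (rule add)

text \<open>
  For a convex cone \<open>S\<close> of pairs \<open>(y, s)\<close> with \<open>s \<le> q y\<close>, the infimum of \<open>q (x + y) - s\<close> over \<open>(y, s) \<in> S\<close>
  is sublinear. A linear functional \<open>g\<close> below it satisfies \<open>g (- y) \<le> - s\<close>, that is, \<open>s \<le> g y\<close>.
\<close>
lemma sublinear_inf_shift:
  assumes q: "sublinear q"
    and S0: "(0, 0) \<in> S"
    and S_add: "\<And>y s z t. (y, s) \<in> S \<Longrightarrow> (z, t) \<in> S \<Longrightarrow> (y + z, s + t) \<in> S"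
    and S_scale: "\<And>y s c. (y, s) \<in> S \<Longrightarrow> 0 < c \<Longrightarrow> (c *\<^sub>R y, c * s) \<in> S"
    and S_le: "\<And>y s. (y, s) \<in> S \<Longrightarrow> s \<le> q y"
  obtains p where "sublinear p" and "\<And>x y s. (y, s) \<in> S \<Longrightarrow> p x \<le> q (x + y) - s"
proof -
  define F where "F x = (\<lambda>(y, s). q (x + y) - s) ` S" for x
  define p where "p x = Inf (F x)" for x
  have ne: "F x \<noteq> {}" for x
    using S0 by (auto simp: F_def)
  have lower: "- q (- x) \<le> v" if v: "v \<in> F x" for x v
  proof -
    obtain y s where "(y, s) \<in> S" "v = q (x + y) - s"
      using v by (auto simp: F_def)
    moreover have "q y \<le> q (x + y) + q (- x)"
      using sublinear_add[OF q, of "x + y" "- x"] by simp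
    ultimately show ?thesis
      using S_le by fastforce
  qed
  have bdd: "bdd_below (F x)" for x
    using lower by (meson bdd_belowI)
  have p_le: "p x \<le> q (x + y) - s" if "(y, s) \<in> S" for x y s
    unfolding p_def by (rule cInf_lower[OF _ bdd]) (use that in \<open>force simp: F_def\<close>)
  have add: "p (x + x') \<le> p x + p x'" for x x'
  proof -
    have "p (x + x') \<le> v + w" if vw: "v \<in> F x" "w \<in> F x'" for v w
    proof -
      obtain y s z t where *: "(y, s) \<in> S" "v = q (x + y) - s" "(z, t) \<in> S" "w = q (x' + z) - t"
        using vw by (auto simp: F_def)
      have "p (x + x') \<le> q ((x + x') + (y + z)) - (s + t)"
        using p_le[OF S_add[OF *(1,3)]] .
      also have "\<dots> \<le> v + w"
        using sublinear_add[OF q, of "x + y" "x' + z"] * by (simp add: algebra_simps)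
      finally show ?thesis .
    qed
    then have "p (x + x') - w \<le> p x" if "w \<in> F x'" for w
      unfolding p_def[of x] by (intro cInf_greatest[OF ne]) (use that in \<open>force simp: algebra_simps\<close>)
    then have "p (x + x') - p x \<le> p x'"
      unfolding p_def[of x'] by (intro cInf_greatest[OF ne]) (force simp: algebra_simps)
    then show ?thesis by simp
  qed
  have scale: "p (c *\<^sub>R x) \<le> c * p x" if c: "0 < c" for c x
  proof -
    have "p (c *\<^sub>R x) / c \<le> v" if v: "v \<in> F x" for v
    proof -
      obtain y s where *: "(y, s) \<in> S" "v = q (x + y) - s"
        using v by (auto simp: F_def)
      have "p (c *\<^sub>R x) \<le> q (c *\<^sub>R x + c *\<^sub>R y) - c * s"
        using p_le[OF S_scale[OF *(1) c]] .
      also have "\<dots> = c * v"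
        using sublinear_scale[OF q, of c "x + y"] c *(2) by (simp add: scaleR_add_right right_diff_distrib)
      finally show ?thesis
        using c by (simp add: field_simps)
    qed
    then have "p (c *\<^sub>R x) / c \<le> p x"
      unfolding p_def[of x] by (rule cInf_greatest[OF ne])
    then show ?thesis
      using c by (simp add: field_simps)
  qed
  have "p 0 = 0"
  proof (rule antisym)
    show "p 0 \<le> 0"
      using p_le[OF S0, of 0] sublinear_zero[OF q] by simp
    show "0 \<le> p 0"
      unfolding p_def using lower[of _ 0] sublinear_zero[OF q] by (intro cInf_greatest[OF ne]) auto
  qed
  then show ?thesis
    using that[of p] sublinearI add scale p_le by blast
qed

text \<open>
  The pointwise infimum of a nonempty chain of sublinear functionals below \<open>p\<close> is finite, because
  each of them is bounded below by \<open>- p (- x)\<close> at \<open>x\<close>.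
\<close>
lemma minimal_sublinear:
  fixes p :: "'a::real_vector \<Rightarrow> real"
  assumes p: "sublinear p"
  obtains m where "sublinear m" "m \<le> p" "\<And>q. sublinear q \<Longrightarrow> q \<le> m \<Longrightarrow> q = m"
proof -
  define A where "A = {q. sublinear q \<and> q \<le> p}"
  have "\<exists>m\<in>A. \<forall>a\<in>A. a \<le> m \<longrightarrow> a = m"
  proof (rule predicate_Zorn[of A "\<lambda>x y. y \<le> x"])
    show "partial_order_on A (relation_of (\<lambda>x y. y \<le> x) A)"
      by (rule partial_order_on_relation_ofI) auto
  next
    fix C
    assume C: "C \<in> Chains (relation_of (\<lambda>x y. y \<le> x) A)"
    then have CA: "C \<subseteq> A" and chain: "\<And>q r. q \<in> C \<Longrightarrow> r \<in> C \<Longrightarrow> q \<le> r \<or> r \<le> q"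
      by (auto simp: Chains_def relation_of_def)
    show "\<exists>u\<in>A. \<forall>a\<in>C. u \<le> a"
    proof (cases "C = {}")
      case True
      then show ?thesis
        using p by (auto simp: A_def)
    next
      case ne: False
      define u where "u x = (INF q\<in>C. q x)" for x
      have sub: "sublinear q" "q \<le> p" if "q \<in> C" for q
        using CA that by (auto simp: A_def)
      have "- p (- x) \<le> q x" if "q \<in> C" for q x
        using sublinear_minus_ge[OF sub(1)[OF that], of x] sub(2)[OF that] by (smt (verit) le_funD)
      then have bdd: "bdd_below ((\<lambda>q. q x) ` C)" for x
        by (meson bdd_belowI2)
      have u_le: "u x \<le> q x" if "q \<in> C" for q x
        unfolding u_def by (rule cINF_lower[OF bdd that])
      have add: "u (x + y) \<le> u x + u y" for x y
      proof -
        have "u (x + y) \<le> q x + r y" if qr: "q \<in> C" "r \<in> C" for q r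
        proof -
          obtain m where m: "m \<in> C" "m \<le> q" "m \<le> r"
            using chain[OF qr] qr by auto
          have "u (x + y) \<le> m x + m y"
            using u_le[OF m(1)] sublinear_add[OF sub(1)[OF m(1)]] by (rule order_trans)
          then show ?thesis
            using m(2,3) by (smt (verit) le_funD)
        qed
        then have "u (x + y) - r y \<le> u x" if "r \<in> C" for r
          unfolding u_def[of x] by (intro cINF_greatest[OF ne]) (use that in \<open>force simp: algebra_simps\<close>)
        then have "u (x + y) - u x \<le> u y"
          unfolding u_def[of y] by (intro cINF_greatest[OF ne]) (force simp: algebra_simps)
        then show ?thesis by simp
      qed
      have scale: "u (t *\<^sub>R x) \<le> t * u x" if t: "0 < t" for t x
      proof -
        have "u (t *\<^sub>R x) / t \<le> q x" if "q \<in> C" for q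
          using u_le[OF that, of "t *\<^sub>R x"] sublinear_scale[OF sub(1)[OF that], of t x] t
          by (simp add: field_simps)
        then have "u (t *\<^sub>R x) / t \<le> u x"
          unfolding u_def[of x] by (rule cINF_greatest[OF ne])
        then show ?thesis
          using t by (simp add: field_simps)
      qed
      have "u 0 = 0"
        unfolding u_def using ne by (simp add: sublinear_zero[OF sub(1)] cong: INF_cong_simp)
      then have "sublinear u"
        using sublinearI add scale by blast
      moreover have "u \<le> p"
        using ne u_le sub(2) by (meson all_not_in_conv le_fun_def order_trans)
      ultimately show ?thesis
        using u_le by (auto simp: A_def le_fun_def)
    qed
  qed
  then obtain m where m: "m \<in> A" "\<And>a. a \<in> A \<Longrightarrow> a \<le> m \<Longrightarrow> a = m" by blast
  show ?thesis
  proof (rule that)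
    show "sublinear m" "m \<le> p"
      using m(1) by (auto simp: A_def)
    show "q = m" if "sublinear q" "q \<le> m" for q
      using m(2)[of q] that \<open>m \<le> p\<close> by (auto simp: A_def)
  qed
qed

text \<open>
  For a fixed \<open>v\<close> the functional \<open>x \<mapsto> inf {m (x + t v) - t m v | t \<ge> 0}\<close> is sublinear and below
  \<open>m\<close>, so minimality makes it equal to \<open>m\<close>; the value at \<open>t = 1\<close> yields superadditivity.
\<close>
lemma minimal_sublinear_linear:
  assumes m: "sublinear m" and min: "\<And>q. sublinear q \<Longrightarrow> q \<le> m \<Longrightarrow> q = m"
  shows "linear m"
proof -
  have ge: "m x + m v \<le> m (x + v)" for x v
  proof -
    define S where "S = (\<lambda>t. (t *\<^sub>R v, t * m v)) ` {0..}"
    obtain p where p: "sublinear p" "\<And>x y s. (y, s) \<in> S \<Longrightarrow> p x \<le> m (x + y) - s"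
    proof (rule sublinear_inf_shift[OF m, of S])
      show "(0, 0) \<in> S"
        by (force simp: S_def)
      show "(y + z, s + t) \<in> S" if "(y, s) \<in> S" "(z, t) \<in> S" for y s z t
        using that by (force simp: S_def simp flip: scaleR_add_left distrib_right)
      show "(c *\<^sub>R y, c * s) \<in> S" if "(y, s) \<in> S" "0 < c" for y s c
        using that by (force simp: S_def image_iff intro!: bexI[of _ "c * _"])
      show "s \<le> m y" if "(y, s) \<in> S" for y s
        using that by (auto simp: S_def sublinear_scale[OF m])
    qed blast
    have "(0, 0) \<in> S" "(v, m v) \<in> S"
      by (force simp: S_def)+
    then have "p \<le> m" "p x \<le> m (x + v) - m v"
      using p(2)[of 0 0] p(2)[of v "m v"] by (auto simp: le_fun_def)
    then show ?thesis
      using min[OF p(1)] by simp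
  qed
  have add: "m (x + y) = m x + m y" for x y
    using ge sublinear_add[OF m] by (intro antisym)
  have neg: "m (- x) = - m x" for x
    using add[of x "- x"] sublinear_zero[OF m] by simp
  show ?thesis
  proof (rule linearI)
    show "m (t *\<^sub>R x) = t *\<^sub>R m x" for t x
    proof (cases "0 \<le> t")
      case True
      then show ?thesis by (simp add: sublinear_scale[OF m])
    next
      case False
      then show ?thesis
        using sublinear_scale[OF m, of "- t" x] neg[of "t *\<^sub>R x"] by simp
    qed
  qed (rule add)
qed

text \<open>
  A convex set outside the open ball of radius \<open>c\<close> is separated from it by a functional of norm at
  most 1.
\<close>
lemma convex_separation_from_ball:
  fixes C :: "'a::real_normed_vector set"
  assumes C: "convex C" and c: "\<And>y. y \<in> C \<Longrightarrow> c \<le> norm y"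
  obtains g where "linear g" "\<And>x. \<bar>g x\<bar> \<le> norm x" "\<And>y. y \<in> C \<Longrightarrow> c \<le> g y"
proof -
  have norm: "sublinear (norm :: 'a \<Rightarrow> real)"
    by (simp add: sublinear_def norm_triangle_ineq)
  define S where "S = insert (0, 0) {(t *\<^sub>R y, t * c) |t y. 0 < t \<and> y \<in> C}"
  have S_cases: "w = (0, 0) \<or> (\<exists>a u. 0 < a \<and> u \<in> C \<and> w = (a *\<^sub>R u, a * c))" if "w \<in> S" for w
    using that by (auto simp: S_def)
  obtain p where p: "sublinear p" "\<And>x y s. (y, s) \<in> S \<Longrightarrow> p x \<le> norm (x + y) - s"
  proof (rule sublinear_inf_shift[OF norm, of S])
    show "(0, 0) \<in> S"
      by (simp add: S_def)
    show "(y + z, s + t) \<in> S" if yz: "(y, s) \<in> S" "(z, t) \<in> S" for y s z t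
    proof -
      have comb: "(a *\<^sub>R u + b *\<^sub>R v, a * c + b * c) \<in> S" if "0 < a" "u \<in> C" "0 < b" "v \<in> C" for a b u v
      proof -
        have "(a / (a + b)) *\<^sub>R u + (b / (a + b)) *\<^sub>R v \<in> C"
          using that by (intro convexD[OF C]) (auto simp flip: add_divide_distrib)
        moreover have "a *\<^sub>R u + b *\<^sub>R v = (a + b) *\<^sub>R ((a / (a + b)) *\<^sub>R u + (b / (a + b)) *\<^sub>R v)"
          using that by (simp add: scaleR_add_right)
        moreover have "a * c + b * c = (a + b) * c" "0 < a + b"
          using that by (auto simp: algebra_simps)
        ultimately show ?thesis
          unfolding S_def by blast
      qed
      from S_cases[OF yz(1)] S_cases[OF yz(2)] show ?thesis
        using yz comb by (elim disjE exE conjE) auto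
    qed
    show "(d *\<^sub>R y, d * s) \<in> S" if ys: "(y, s) \<in> S" "0 < d" for y s d
    proof -
      have comb: "(d *\<^sub>R (t *\<^sub>R u), d * (t * c)) \<in> S" if "0 < t" "u \<in> C" for t u
        using that \<open>0 < d\<close> unfolding S_def
        by (intro insertI2 CollectI exI[of _ "d * t"] exI[of _ u]) simp
      from S_cases[OF ys(1)] show ?thesis
        using ys comb by (elim disjE exE conjE) auto
    qed
    show "s \<le> norm y" if "(y, s) \<in> S" for y s
      using that c by (auto simp: S_def)
  qed blast
  obtain g where g: "sublinear g" "g \<le> p" "\<And>q. sublinear q \<Longrightarrow> q \<le> g \<Longrightarrow> q = g"
    using minimal_sublinear[OF p(1)] by blast
  have lin: "linear g"
    using minimal_sublinear_linear g by blast
  have g_le: "g x \<le> norm (x + y) - s" if "(y, s) \<in> S" for x y s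
    using p(2)[OF that] g(2) by (meson le_funD order_trans)
  have le: "g x \<le> norm x" for x
    using g_le[of 0 0 x] by (simp add: S_def)
  show ?thesis
  proof (rule that[OF lin])
    show "\<bar>g x\<bar> \<le> norm x" for x
      using le[of x] le[of "- x"] by (simp add: linear_neg[OF lin])
    show "c \<le> g y" if "y \<in> C" for y
    proof -
      have "(y, c) \<in> S"
        using that unfolding S_def by (intro insertI2 CollectI exI[of _ 1] exI[of _ y]) simp
      from g_le[OF this, of "- y"] show ?thesis
        by (simp add: linear_neg[OF lin])
    qed
  qed
qed


section \<open>The scalar field and its dual functionals\<close>

text \<open>
  Working with explicit coordinates avoids transporting along the isomorphism given by the class.
  An additive, multiplicative isometry \<open>h\<close> fixes the real scalars \<open>r\<close>, because the distances of
  \<open>h r\<close> to 0 and 1 are those of \<open>r\<close>.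
\<close>

lemma scalar_field_cases:
  obtains (real) "\<And>a :: 'k::real_or_complex. \<exists>r. a = of_real r"
  | (complex) i :: "'k::real_or_complex" where "i * i = - 1"
      "\<And>a. \<exists>r s. a = of_real r + i * of_real s"
      "\<And>r s. norm (of_real r + i * of_real s) = sqrt (r\<^sup>2 + s\<^sup>2)"
proof -
  consider
      (R) h :: "'k \<Rightarrow> real" where "bij h" "\<And>a b. h (a + b) = h a + h b"
        "\<And>a b. h (a * b) = h a * h b" "\<And>a. norm (h a) = norm a"
    | (C) h :: "'k \<Rightarrow> complex" where "bij h" "\<And>a b. h (a + b) = h a + h b"
        "\<And>a b. h (a * b) = h a * h b" "\<And>a. norm (h a) = norm a"
    using iso_real_or_complex[where 'a = 'k] by blast
  then show ?thesis
  proof cases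
    case R
    have one: "h 1 = 1"
      using R(3)[of 1 1] R(4)[of 1] by auto
    have diff: "h (a - b) = h a - h b" for a b
      using R(2)[of "a - b" b] by simp
    have "h (of_real r) = r" for r
    proof -
      have "\<bar>h (of_real r)\<bar> = \<bar>r\<bar>"
        using R(4)[of "of_real r"] by simp
      moreover have "\<bar>h (of_real r) - 1\<bar> = \<bar>r - 1\<bar>"
        using R(4)[of "of_real (r - 1)"] unfolding norm_of_real by (simp add: diff one)
      ultimately show ?thesis by linarith
    qed
    then have "a = of_real (h a)" for a
      using R(1) by (metis bij_pointE)
    then show ?thesis
      using real by blast
  next
    case C
    have one: "h 1 = 1"
      using C(3)[of 1 1] C(4)[of 1] by auto
    have diff: "h (a - b) = h a - h b" for a b
      using C(2)[of "a - b" b] by simp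
    have h_real: "h (of_real r) = of_real r" for r
    proof -
      define z where "z = h (of_real r)"
      have "cmod z = \<bar>r\<bar>"
        using C(4)[of "of_real r"] by (simp add: z_def)
      moreover have "cmod (z - 1) = \<bar>r - 1\<bar>"
        using C(4)[of "of_real (r - 1)"] unfolding norm_of_real by (simp add: diff one z_def)
      ultimately have 1: "(Re z)\<^sup>2 + (Im z)\<^sup>2 = r\<^sup>2" "(Re z - 1)\<^sup>2 + (Im z)\<^sup>2 = (r - 1)\<^sup>2"
        by (metis cmod_power2 power2_abs, metis cmod_power2 power2_abs minus_complex.simps one_complex.simps diff_zero)
      then have Re: "Re z = r"
        by (simp add: power2_eq_square algebra_simps)
      with 1(1) have "Im z = 0" by simp
      with Re show ?thesis
        by (simp add: z_def complex_eq_iff)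
    qed
    obtain i where i: "h i = \<i>"
      using C(1) by (metis bij_pointE)
    have h_comb: "h (of_real r + i * of_real s) = Complex r s" for r s
      by (simp add: C(2,3) h_real i complex_eq_iff)
    show ?thesis
    proof (rule complex)
      have inj: "inj h"
        using C(1) by (rule bij_is_inj)
      have "h (i * i) = h (- 1)"
        using h_real[of "-1"] by (simp add: C(3) i)
      then show "i * i = - 1"
        by (rule injD[OF inj])
      have "a = of_real (Re (h a)) + i * of_real (Im (h a))" for a
        by (rule injD[OF inj]) (simp add: h_comb)
      then show "\<exists>r s. a = of_real r + i * of_real s" for a
        by blast
      show "norm (of_real r + i * of_real s) = sqrt (r\<^sup>2 + s\<^sup>2)" for r s
        by (simp add: h_comb complex_norm flip: C(4))
    qed
  qed
qed

lemma compact_scalar_ball: "compact (cball 0 1 :: 'k::real_or_complex set)"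
proof (cases rule: scalar_field_cases[where 'k = 'k])
  case real
  have "cball 0 1 \<subseteq> (of_real :: real \<Rightarrow> 'k) ` cball 0 1"
  proof
    fix a :: 'k
    assume "a \<in> cball 0 1"
    moreover obtain r where "a = of_real r"
      using real by blast
    ultimately show "a \<in> of_real ` (cball 0 1 :: real set)"
      by (intro image_eqI[of _ _ r]) auto
  qed
  moreover have "compact ((of_real :: real \<Rightarrow> 'k) ` cball 0 1)"
    by (intro compact_continuous_image continuous_intros compact_cball)
  ultimately show ?thesis
    by (metis closed_cball compact_Int_closed inf.absorb_iff2)
next
  case (complex i)
  let ?f = "\<lambda>(r, s). of_real r + i * of_real s"
  have "cball 0 1 \<subseteq> ?f ` (cball 0 1 \<times> cball 0 1)"
  proof
    fix a :: 'k
    assume a: "a \<in> cball 0 1"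
    obtain r s where rs: "a = of_real r + i * of_real s"
      using complex(2) by blast
    have "\<bar>r\<bar> \<le> norm a" "\<bar>s\<bar> \<le> norm a"
      unfolding rs complex(3) by (simp_all add: real_le_rsqrt)
    then show "a \<in> ?f ` (cball 0 1 \<times> cball 0 1)"
      using a rs by (intro image_eqI[of _ _ "(r, s)"]) auto
  qed
  moreover have "compact (?f ` (cball 0 1 \<times> cball 0 1))"
    unfolding case_prod_unfold
    by (intro compact_continuous_image continuous_intros compact_Times compact_cball)
  ultimately show ?thesis
    by (metis closed_cball compact_Int_closed inf.absorb_iff2)
qed

context banach_space_over
begin

lemma dual_unit_ballI:
  assumes add: "\<And>x y. f (x + y) = f x + f y" and scale: "\<And>a x. f (smul a x) = a * f x"
    and bound: "\<And>x. norm (f x) \<le> norm x"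
  shows "f \<in> dual_unit_ball smul"
proof -
  have "Vector_Spaces.linear smul (*) f"
    by unfold_locales (auto simp: add scale algebra_simps)
  moreover have "bounded_linear f"
  proof (rule bounded_linear_intro[of _ 1])
    show "f (r *\<^sub>R x) = r *\<^sub>R f x" for r x
      using scale[of "of_real r" x] by (simp add: smul_of_real scaleR_conv_of_real)
  qed (use add bound in auto)
  moreover have "onorm f \<le> 1"
    by (rule onorm_bound) (use bound in auto)
  ultimately show ?thesis
    by (simp add: dual_unit_ball_def)
qed

text \<open>
  Over the complex numbers the functional is the usual \<open>f x = g x - i g (i x)\<close>; its norm is at most 1
  because \<open>f x\<close> can be rotated to be a nonnegative real, where it coincides with a value of \<open>g\<close>.
\<close>
lemma dual_functional_dominating_real:
  assumes g: "linear g" and le: "\<And>x. \<bar>g x\<bar> \<le> norm x"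
  obtains f where "f \<in> dual_unit_ball smul" "\<And>x. \<bar>g x\<bar> \<le> norm (f x)"
proof (cases rule: scalar_field_cases[where 'k = 'k])
  case real
  have "(\<lambda>x. of_real (g x)) \<in> dual_unit_ball smul"
  proof (rule dual_unit_ballI)
    show "of_real (g (smul a x)) = a * (of_real (g x))" for a x
    proof -
      obtain r where "a = of_real r"
        using real by blast
      then show ?thesis
        by (simp add: smul_of_real linear_cmul[OF g])
    qed
  qed (auto simp: linear_add[OF g] le)
  then show ?thesis
    by (rule that) simp
next
  case (complex i)
  define f where "f x = of_real (g x) + i * of_real (- g (smul i x))" for x
  have norm_f: "norm (f x) = sqrt ((g x)\<^sup>2 + (g (smul i x))\<^sup>2)" for x
    unfolding f_def complex(3) by simp
  have add: "f (x + y) = f x + f y" for x y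
    by (simp add: f_def scale_right_distrib linear_add[OF g] algebra_simps)
  have scale: "f (smul a x) = a * f x" for a x
  proof -
    obtain r s where a: "a = of_real r + i * of_real s"
      using complex(2) by blast
    have ax: "smul a x = r *\<^sub>R x + s *\<^sub>R smul i x"
      unfolding a by (metis mult.commute scale_left_distrib scale_scale smul_of_real)
    have "i * a = of_real r * i + of_real (- s)"
      using complex(1) by (simp add: a algebra_simps flip: mult.assoc)
    then have iax: "smul i (smul a x) = r *\<^sub>R smul i x + (- s) *\<^sub>R x"
      by (metis scale_left_distrib scale_scale smul_of_real)
    have "f (smul a x) = of_real (r * g x + s * g (smul i x)) + i * of_real (s * g x - r * g (smul i x))"
      unfolding f_def iax unfolding ax by (simp add: linear_add[OF g] linear_cmul[OF g] linear_diff[OF g])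
    also have "\<dots> = a * f x - (1 + i * i) * of_real s * of_real (g (smul i x)) * (- 1)"
      by (simp add: a f_def algebra_simps)
    finally show ?thesis
      using complex(1) by simp
  qed
  have bound: "norm (f x) \<le> norm x" for x
  proof (cases "f x = 0")
    case False
    \<comment> \<open>The unimodular scalar that turns \<open>f x\<close> into its modulus.\<close>
    define c where "c = of_real (norm (f x)) / f x"
    have c: "norm c = 1"
      using False by (simp add: c_def norm_divide)
    have "f (smul c x) = of_real (norm (f x))"
      using False by (simp add: scale c_def)
    then have "of_real (g (smul c x) - norm (f x)) + i * of_real (- g (smul i (smul c x))) = 0"
      by (simp add: f_def[of "smul c x"] algebra_simps)
    then have "sqrt ((g (smul c x) - norm (f x))\<^sup>2 + (g (smul i (smul c x)))\<^sup>2) = 0"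
      using complex(3)[of "g (smul c x) - norm (f x)" "- g (smul i (smul c x))"] by simp
    then have "norm (f x) = g (smul c x)"
      by (simp add: add_nonneg_eq_0_iff)
    also have "\<dots> \<le> norm x"
      using le[of "smul c x"] c by (simp add: norm_smul)
    finally show ?thesis .
  qed simp
  show ?thesis
    by (rule that[OF dual_unit_ballI[OF add scale bound]]) (simp add: norm_f real_le_rsqrt)
qed

end


section \<open>Asymptotically additive subsequences\<close>

text \<open>
  The limes inferior is attained along some subsequence, so knowing the limes superior of all
  subsequences is enough for convergence.
\<close>

lemma tendsto_if_limsup_subseqs:
  fixes a :: "nat \<Rightarrow> real"
  assumes "\<And>r. strict_mono r \<Longrightarrow> limsup (\<lambda>n. ereal (a (r n))) = ereal L"
  shows "a \<longlonglongrightarrow> L"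
proof -
  let ?e = "\<lambda>n. ereal (a n)"
  have "\<exists>r. strict_mono r \<and> (?e \<circ> r) \<longlonglongrightarrow> liminf ?e"
    by (rule liminf_subseq_lim)
  then obtain r where "strict_mono r" "(?e \<circ> r) \<longlonglongrightarrow> liminf ?e" by blast
  then have "liminf ?e = limsup (\<lambda>n. ereal (a (r n)))"
    using lim_imp_Limsup[of sequentially "?e \<circ> r"] by (simp add: comp_def)
  also have "\<dots> = ereal L"
    by (rule assms) fact
  finally have "liminf ?e = ereal L" .
  moreover have "limsup ?e = ereal L"
    using assms[of id] by (simp add: strict_mono_def)
  ultimately have "?e \<longlonglongrightarrow> ereal L"
    using tendsto_iff_Liminf_eq_Limsup[of sequentially ?e "ereal L"] by simp
  then show ?thesis by simp
qed

lemma limitin_translate: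
  assumes "linear_topology smul \<tau>" and "limitin \<tau> x l F"
  shows "limitin \<tau> (\<lambda>n. x n + c) (l + c) F"
proof -
  have top: "topspace \<tau> = UNIV" and cont: "continuous_map (prod_topology \<tau> \<tau>) \<tau> (\<lambda>(x, y). x + y)"
    using assms(1) by (auto simp: linear_topology_def)
  have "limitin (prod_topology \<tau> \<tau>) (\<lambda>n. (x n, c)) (l, c) F"
    using assms(2) top by (simp add: limitin_pairwise comp_def)
  from continuous_map_limit[OF cont this] show ?thesis
    by (simp add: comp_def)
qed

lemma subseq_asymptotically_additive:
  fixes smul :: "'k::real_or_complex \<Rightarrow> 'a::banach \<Rightarrow> 'a" and x :: "nat \<Rightarrow> 'a"
  assumes lin: "linear_topology smul \<tau>"
    and conv: "\<And>x :: nat \<Rightarrow> 'a. bounded (range x) \<Longrightarrow>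
           \<exists>r l. strict_mono (r :: nat \<Rightarrow> nat) \<and> limitin \<tau> (x \<circ> r) l sequentially"
    and add: "\<And>(x :: nat \<Rightarrow> 'a) y. bounded (range x) \<Longrightarrow> limitin \<tau> x 0 sequentially \<Longrightarrow>
           limsup (\<lambda>n. ereal (norm (x n + y))) = ereal (norm y) + limsup (\<lambda>n. ereal (norm (x n)))"
    and bdd: "bounded (range x)"
  obtains r l \<rho> where "strict_mono (r :: nat \<Rightarrow> nat)"
    "\<And>u. (\<lambda>n. norm (x (r n) - l + u)) \<longlonglongrightarrow> norm u + \<rho>"
proof -
  obtain r l where r: "strict_mono (r :: nat \<Rightarrow> nat)" and l: "limitin \<tau> (x \<circ> r) l sequentially"
    using conv[OF bdd] by blast
  define z where "z n = x (r n) - l" for n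
  have z0: "limitin \<tau> z 0 sequentially"
    using limitin_translate[OF lin l, of "- l"] by (simp add: z_def[abs_def])
  have "bounded ((\<lambda>y. y - l) ` range x)"
    using bdd by (rule bounded_translation_minus)
  then have z_bdd: "bounded (range z)"
    by (rule bounded_subset) (auto simp: z_def)
  then have "bounded (range (\<lambda>n. norm (z n)))"
    by (simp add: bounded_iff)
  then obtain \<rho> s where s: "strict_mono (s :: nat \<Rightarrow> nat)" and \<rho>: "((\<lambda>n. norm (z n)) \<circ> s) \<longlonglongrightarrow> \<rho>"
    by (metis bounded_imp_convergent_subsequence)
  show ?thesis
  proof (rule that)
    show "strict_mono (r \<circ> s)"
      using r s by (rule strict_mono_o)
    show "(\<lambda>n. norm (x ((r \<circ> s) n) - l + u)) \<longlonglongrightarrow> norm u + \<rho>" for u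
    proof (rule tendsto_if_limsup_subseqs)
      fix t :: "nat \<Rightarrow> nat"
      assume t: "strict_mono t"
      let ?w = "\<lambda>n. z (s (t n))"
      have "limitin \<tau> (z \<circ> (s \<circ> t)) 0 sequentially"
        by (intro limitin_subsequence strict_mono_o s t z0)
      then have "limitin \<tau> ?w 0 sequentially"
        by (simp add: comp_def)
      moreover have "bounded (range ?w)"
        by (rule bounded_subset[OF z_bdd]) auto
      ultimately have "limsup (\<lambda>n. ereal (norm (?w n + u))) = ereal (norm u) + limsup (\<lambda>n. ereal (norm (?w n)))"
        by (intro add)
      moreover have "(\<lambda>n. ereal (norm (?w n))) \<longlonglongrightarrow> ereal \<rho>"
        using LIMSEQ_subseq_LIMSEQ[OF \<rho> t] by (simp add: comp_def)
      then have "limsup (\<lambda>n. ereal (norm (?w n))) = ereal \<rho>"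
        by (intro lim_imp_Limsup) auto
      ultimately show "limsup (\<lambda>n. ereal (norm (x ((r \<circ> s) (t n)) - l + u))) = ereal (norm u + \<rho>)"
        by (simp add: z_def)
    qed
  qed
qed

context banach_space_over
begin

lemma bounded_bilinear_smul: "bounded_bilinear smul"
proof
  show "smul (r *\<^sub>R a) x = r *\<^sub>R smul a x" "smul a (r *\<^sub>R x) = r *\<^sub>R smul a x" for r a x
    by (metis mult.commute scale_scale scaleR_conv_of_real smul_of_real)+
  show "\<exists>K. \<forall>a b. norm (smul a b) \<le> norm a * norm b * K"
    by (intro exI[of _ 1]) (simp add: norm_smul)
qed (auto simp: scale_left_distrib scale_right_distrib)

lemma compact_add_smul:
  assumes "compact C"
  shows "compact ((\<lambda>(u, a). u + smul a v) ` (C \<times> cball 0 1))"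
  unfolding case_prod_unfold
  by (intro compact_continuous_image compact_Times compact_scalar_ball assms
      continuous_intros bounded_bilinear.continuous_on[OF bounded_bilinear_smul])

section \<open>Lower estimates for linear combinations\<close>

text \<open>
  Uniformity on compact sets. Failing vectors and coefficients would accumulate at some pair, and
  the norms are Lipschitz in that pair uniformly in the index.
\<close>

lemma eventually_norm_add_ge:
  assumes z: "\<And>u. (\<lambda>n. norm (z n + u)) \<longlonglongrightarrow> norm u + \<rho>"
    and C: "compact C" and \<eta>: "0 < \<eta>"
  shows "\<forall>\<^sub>F n in sequentially. \<forall>u\<in>C. \<forall>a. norm a \<le> 1 \<longrightarrow>
    norm u + norm a * \<rho> - \<eta> \<le> norm (u + smul a (z n))"
proof (rule ccontr)
  let ?bad = "\<lambda>n w. norm (fst w + smul (snd w) (z n)) < norm (fst w) + norm (snd w) * \<rho> - \<eta>"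
  assume "\<not> ?thesis"
  then have "\<exists>n\<ge>N. \<exists>w\<in>C \<times> cball 0 1. ?bad n w" for N
    unfolding eventually_sequentially by (force simp: not_le)
  then obtain n w where n: "\<And>N. n N \<ge> N" and w: "\<And>N. w N \<in> C \<times> cball 0 1" "\<And>N. ?bad (n N) (w N)"
    by metis
  have "seq_compact (C \<times> (cball 0 1 :: 'k set))"
    by (intro compact_imp_seq_compact compact_Times C compact_scalar_ball)
  then obtain q r where r: "strict_mono (r :: nat \<Rightarrow> nat)" and q: "(w \<circ> r) \<longlonglongrightarrow> q"
    using w(1) unfolding seq_compact_def by metis
  define k where "k = n \<circ> r"
  have k: "filterlim k sequentially sequentially"
    unfolding filterlim_at_top k_def eventually_sequentially
    using n seq_suble[OF r] by (metis comp_apply order_trans)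
  define u where "u N = fst (w (r N))" for N
  define a where "a N = snd (w (r N))" for N
  have u: "u \<longlonglongrightarrow> fst q" and a: "a \<longlonglongrightarrow> snd q"
    using tendsto_fst[OF q] tendsto_snd[OF q] by (simp_all add: u_def[abs_def] a_def[abs_def])
  have bad: "norm (u N + smul (a N) (z (k N))) \<le> norm (u N) + norm (a N) * \<rho> - \<eta>" for N
    using w(2)[of "r N"] by (simp add: u_def a_def k_def)
  have lim: "(\<lambda>n. norm (fst q + smul (snd q) (z n))) \<longlonglongrightarrow> norm (fst q) + norm (snd q) * \<rho>"
  proof (cases "snd q = 0")
    case False
    have "norm (fst q + smul (snd q) (z n)) = norm (snd q) * norm (z n + smul (1 / snd q) (fst q))" for n
      using False by (simp add: scale_right_distrib add.commute flip: norm_smul)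
    moreover have "(\<lambda>n. norm (snd q) * norm (z n + smul (1 / snd q) (fst q)))
        \<longlonglongrightarrow> norm (snd q) * (norm (smul (1 / snd q) (fst q)) + \<rho>)"
      by (intro tendsto_mult_left z)
    moreover have "norm (snd q) * (norm (smul (1 / snd q) (fst q)) + \<rho>) = norm (fst q) + norm (snd q) * \<rho>"
      using False by (simp add: norm_smul norm_divide distrib_left)
    ultimately show ?thesis by simp
  qed simp
  have zk: "(\<lambda>N. norm (z (k N))) \<longlonglongrightarrow> \<rho>"
    using filterlim_compose[OF z[of 0] k] by simp
  let ?err = "\<lambda>N. norm (u N - fst q) + norm (a N - snd q) * norm (z (k N))"
  have "?err \<longlonglongrightarrow> norm (fst q - fst q) + norm (snd q - snd q) * \<rho>"
    by (intro tendsto_intros u a zk)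
  then have "(\<lambda>N. norm (fst q + smul (snd q) (z (k N))) - ?err N) \<longlonglongrightarrow> norm (fst q) + norm (snd q) * \<rho>"
    using tendsto_diff[OF filterlim_compose[OF lim k]] by fastforce
  moreover have "(\<lambda>N. norm (u N) + norm (a N) * \<rho> - \<eta>) \<longlonglongrightarrow> norm (fst q) + norm (snd q) * \<rho> - \<eta>"
    by (intro tendsto_intros u a)
  moreover have "norm (fst q + smul (snd q) (z (k N))) - ?err N \<le> norm (u N) + norm (a N) * \<rho> - \<eta>" for N
  proof -
    have "fst q + smul (snd q) (z (k N)) =
        (u N + smul (a N) (z (k N))) - ((u N - fst q) + smul (a N - snd q) (z (k N)))"
      by (simp add: scale_left_diff_distrib)
    then have "norm (fst q + smul (snd q) (z (k N))) \<le> norm (u N + smul (a N) (z (k N))) + ?err N"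
      by (smt (verit) norm_smul norm_triangle_ineq norm_triangle_ineq4)
    then show ?thesis
      using bad[of N] by linarith
  qed
  ultimately have "norm (fst q) + norm (snd q) * \<rho> \<le> norm (fst q) + norm (snd q) * \<rho> - \<eta>"
    by (intro LIMSEQ_le) auto
  with \<eta> show False by simp
qed

text \<open>
  Bounding all coefficients by 1 keeps the combinations of the first \<open>m\<close> terms in a compact set, so
  the next index can be chosen with error at most \<open>\<eta> / 2\<close> to the power \<open>m + 1\<close>, uniformly on that
  set.
\<close>
lemma subseq_norm_sum_ge_unit:
  assumes z: "\<And>u. (\<lambda>n. norm (z n + u)) \<longlonglongrightarrow> norm u + \<rho>" and \<eta>: "0 < \<eta>"
  obtains r where "strict_mono (r :: nat \<Rightarrow> nat)"
    "\<And>m s \<alpha>. norm s \<le> 1 \<Longrightarrow> (\<And>j. j < m \<Longrightarrow> norm (\<alpha> j) \<le> 1) \<Longrightarrow>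
      norm s * norm l + \<rho> * (\<Sum>j<m. norm (\<alpha> j)) - \<eta> \<le> norm (smul s l + (\<Sum>j<m. smul (\<alpha> j) (z (r j))))"
proof -
  define good where "good m C n \<longleftrightarrow> (\<forall>u\<in>C. \<forall>a. norm a \<le> 1 \<longrightarrow>
    norm u + norm a * \<rho> - \<eta> * (1 / 2) ^ Suc m \<le> norm (u + smul a (z n)))" for m C n
  define grow where "grow C n = (\<lambda>(u, a). u + smul a (z n)) ` (C \<times> cball 0 1)" for C n
  let ?P = "\<lambda>m w. compact (snd w) \<and> (m = 0 \<longrightarrow> (\<lambda>a. smul a l) ` cball 0 1 \<subseteq> snd w)"
  let ?Q = "\<lambda>m w w'. fst w < fst w' \<and> good m (snd w) (fst w') \<and> snd w' = grow (snd w) (fst w')"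
  \<comment> \<open>State of the construction: the index chosen last, and a compact set containing the combinations
    of \<open>l\<close> and the terms chosen so far with coefficients of modulus at most 1. The index of the
    initial state is not part of the subsequence.\<close>
  have "\<exists>f :: nat \<Rightarrow> nat \<times> 'a set. \<forall>m. ?P m (f m) \<and> ?Q m (f m) (f (Suc m))"
  proof (rule dependent_nat_choice[where P = ?P and Q = ?Q])
    have "compact ((\<lambda>(u, a). u + smul a l) ` ({0} \<times> cball 0 1))"
      by (intro compact_add_smul) simp
    then show "\<exists>w :: nat \<times> 'a set. ?P 0 w"
      by (intro exI[of _ "(0, (\<lambda>(u, a). u + smul a l) ` ({0} \<times> cball 0 1))"]) force
  next
    fix w :: "nat \<times> 'a set" and m :: nat
    assume w: "?P m w"
    have "\<forall>\<^sub>F n in sequentially. good m (snd w) n"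
      unfolding good_def by (rule eventually_norm_add_ge[OF z]) (use w \<eta> in auto)
    then have "\<forall>\<^sub>F n in sequentially. good m (snd w) n \<and> fst w < n"
      by (intro eventually_conj eventually_gt_at_top)
    then obtain n where "good m (snd w) n" "fst w < n"
      using eventually_happens'[OF sequentially_bot] by blast
    moreover have "compact (grow (snd w) n)"
      unfolding grow_def using w by (intro compact_add_smul) simp
    ultimately show "\<exists>w'. ?P (Suc m) w' \<and> ?Q m w w'"
      by (intro exI[of _ "(n, grow (snd w) n)"]) simp
  qed
  then obtain f where "\<forall>m. ?P m (f m) \<and> ?Q m (f m) (f (Suc m))" ..
  then have f: "?P m (f m)" "?Q m (f m) (f (Suc m))" for m
    by simp_all
  define r where "r j = fst (f (Suc j))" for j
  have mono: "strict_mono r"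
    using f(2) by (auto simp: strict_mono_Suc_iff r_def)
  have ind: "smul s l + (\<Sum>j<m. smul (\<alpha> j) (z (r j))) \<in> snd (f m) \<and>
      norm s * norm l + \<rho> * (\<Sum>j<m. norm (\<alpha> j)) - \<eta> * (1 - (1 / 2) ^ m)
        \<le> norm (smul s l + (\<Sum>j<m. smul (\<alpha> j) (z (r j))))"
    if s: "norm s \<le> 1" and \<alpha>: "\<And>j. j < m \<Longrightarrow> norm (\<alpha> j) \<le> 1" for m s \<alpha>
    using \<alpha>
  proof (induction m)
    case 0
    then show ?case
      using f(1)[of 0] s by (force simp: norm_smul)
  next
    case (Suc m)
    define u where "u = smul s l + (\<Sum>j<m. smul (\<alpha> j) (z (r j)))"
    have u: "u \<in> snd (f m)"
        "norm s * norm l + \<rho> * (\<Sum>j<m. norm (\<alpha> j)) - \<eta> * (1 - (1 / 2) ^ m) \<le> norm u"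
      using Suc by (auto simp: u_def)
    have am: "norm (\<alpha> m) \<le> 1"
      using Suc.prems by simp
    have "norm u + norm (\<alpha> m) * \<rho> - \<eta> * (1 / 2) ^ Suc m \<le> norm (u + smul (\<alpha> m) (z (r m)))"
      using f(2)[of m] u(1) am by (auto simp: good_def r_def)
    moreover have "u + smul (\<alpha> m) (z (r m)) \<in> snd (f (Suc m))"
      using f(2)[of m] u(1) am by (force simp: grow_def r_def)
    moreover have "smul s l + (\<Sum>j<Suc m. smul (\<alpha> j) (z (r j))) = u + smul (\<alpha> m) (z (r m))"
      by (simp add: u_def)
    moreover have "norm s * norm l + \<rho> * (\<Sum>j<Suc m. norm (\<alpha> j)) - \<eta> * (1 - (1 / 2) ^ Suc m) =
        (norm s * norm l + \<rho> * (\<Sum>j<m. norm (\<alpha> j)) - \<eta> * (1 - (1 / 2) ^ m)) +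
        (norm (\<alpha> m) * \<rho> - \<eta> * (1 / 2) ^ Suc m)"
      by (simp add: algebra_simps)
    ultimately show ?case
      using u(2) by (simp only: simp_thms)
  qed
  show ?thesis
  proof (rule that[OF mono])
    fix m and s :: 'k and \<alpha> :: "nat \<Rightarrow> 'k"
    assume "norm s \<le> 1" "\<And>j. j < m \<Longrightarrow> norm (\<alpha> j) \<le> 1"
    from ind[OF this]
    have "norm s * norm l + \<rho> * (\<Sum>j<m. norm (\<alpha> j)) - \<eta> * (1 - (1 / 2) ^ m)
        \<le> norm (smul s l + (\<Sum>j<m. smul (\<alpha> j) (z (r j))))" ..
    moreover have "\<eta> * (1 - (1 / 2) ^ m) \<le> \<eta>"
      using \<eta> by simp
    ultimately show "norm s * norm l + \<rho> * (\<Sum>j<m. norm (\<alpha> j)) - \<eta>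
        \<le> norm (smul s l + (\<Sum>j<m. smul (\<alpha> j) (z (r j))))" by linarith
  qed
qed

text \<open>Homogeneity removes the bound on the coefficients.\<close>
lemma subseq_norm_sum_ge:
  assumes z: "\<And>u. (\<lambda>n. norm (x n - l + u)) \<longlonglongrightarrow> norm u + \<rho>" and \<eta>: "0 < \<eta>"
  obtains r where "strict_mono (r :: nat \<Rightarrow> nat)"
    "\<And>m \<alpha>. norm (\<Sum>j<m. \<alpha> j) * norm l + (\<rho> - \<eta>) * (\<Sum>j<m. norm (\<alpha> j))
      \<le> norm (\<Sum>j<m. smul (\<alpha> j) (x (r j)))"
proof -
  obtain r where r: "strict_mono (r :: nat \<Rightarrow> nat)"
    and ge: "\<And>m s \<alpha>. norm s \<le> 1 \<Longrightarrow> (\<And>j. j < m \<Longrightarrow> norm (\<alpha> j) \<le> 1) \<Longrightarrow>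
      norm s * norm l + \<rho> * (\<Sum>j<m. norm (\<alpha> j)) - \<eta>
        \<le> norm (smul s l + (\<Sum>j<m. smul (\<alpha> j) (x (r j) - l)))"
    using subseq_norm_sum_ge_unit[OF z \<eta>, where l = l] by blast
  show ?thesis
  proof (rule that[OF r])
    fix m and \<alpha> :: "nat \<Rightarrow> 'k"
    define A where "A = (\<Sum>j<m. norm (\<alpha> j))"
    show "norm (\<Sum>j<m. \<alpha> j) * norm l + (\<rho> - \<eta>) * (\<Sum>j<m. norm (\<alpha> j))
      \<le> norm (\<Sum>j<m. smul (\<alpha> j) (x (r j)))"
    proof (cases "A = 0")
      case True
      then have "\<alpha> j = 0" if "j < m" for j
        using that by (auto simp: A_def sum_nonneg_eq_0_iff)
      then show ?thesis by simp
    next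
      case False
      then have A: "0 < A"
        by (simp add: A_def sum_nonneg order.not_eq_order_implies_strict)
      define c where "c = (of_real (1 / A) :: 'k)"
      have c: "norm c = 1 / A"
        using A unfolding c_def norm_of_real by simp
      have "norm (\<alpha> j) \<le> A" if "j < m" for j
        unfolding A_def using that by (intro member_le_sum) auto
      then have small: "norm (c * \<alpha> j) \<le> 1" if "j < m" for j
        using that A by (simp add: norm_mult c field_simps)
      have "norm (\<Sum>j<m. \<alpha> j) \<le> A"
        unfolding A_def by (rule norm_sum)
      then have "norm (c * (\<Sum>j<m. \<alpha> j)) \<le> 1"
        using A by (simp add: norm_mult c field_simps)
      from ge[OF this small]
      have "norm (c * (\<Sum>j<m. \<alpha> j)) * norm l + \<rho> * (\<Sum>j<m. norm (c * \<alpha> j)) - \<eta>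
        \<le> norm (smul (c * (\<Sum>j<m. \<alpha> j)) l + (\<Sum>j<m. smul (c * \<alpha> j) (x (r j) - l)))"
        by simp
      also have "(\<Sum>j<m. norm (c * \<alpha> j)) = 1 / A * A"
        by (simp add: norm_mult c A_def flip: sum_divide_distrib)
      also have "smul (c * (\<Sum>j<m. \<alpha> j)) l + (\<Sum>j<m. smul (c * \<alpha> j) (x (r j) - l))
          = smul c (\<Sum>j<m. smul (\<alpha> j) (x (r j)))"
        by (simp add: scale_right_diff_distrib sum_subtractf scale_sum_right scale_sum_left
            sum_distrib_left)
      finally have "norm (\<Sum>j<m. \<alpha> j) * norm l / A + \<rho> - \<eta> \<le> norm (\<Sum>j<m. smul (\<alpha> j) (x (r j))) / A"
        using A by (simp add: norm_mult norm_smul c)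
      then have "A * (norm (\<Sum>j<m. \<alpha> j) * norm l / A + \<rho> - \<eta>) \<le> A * (norm (\<Sum>j<m. smul (\<alpha> j) (x (r j))) / A)"
        using A by (intro mult_left_mono) auto
      moreover have "A * (norm (\<Sum>j<m. \<alpha> j) * norm l / A + \<rho> - \<eta>) = norm (\<Sum>j<m. \<alpha> j) * norm l + (\<rho> - \<eta>) * A"
        using A by (simp add: field_simps)
      ultimately show ?thesis
        using A unfolding A_def[symmetric] by simp
    qed
  qed
qed

end


section \<open>Functionals that are large along a subsequence\<close>

text \<open>
  It suffices to bound the norms of convex combinations of the sequence from below: these form a
  convex set, to which the separation theorem applies.
\<close>

lemma functional_bounded_below_on_sequence:
  fixes y :: "nat \<Rightarrow> 'a::real_normed_vector"
  assumes ge: "\<And>m t. (\<And>j. 0 \<le> t j) \<Longrightarrow> (\<Sum>j<m. t j) = 1 \<Longrightarrow> c \<le> norm (\<Sum>j<m. t j *\<^sub>R y j)"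
  obtains g where "linear g" "\<And>x. \<bar>g x\<bar> \<le> norm x" "\<And>j. c \<le> g (y j)"
proof -
  define comb where "comb v m t \<longleftrightarrow> v = (\<Sum>j<m. t j *\<^sub>R y j) \<and>
    (\<forall>j. 0 \<le> t j) \<and> (\<forall>j\<ge>m. t j = 0) \<and> (\<Sum>j<m. t j) = (1::real)" for v m t
  define C where "C = {v. \<exists>m t. comb v m t}"
  \<comment> \<open>Weights vanish from \<open>m\<close> on, so two combinations can be given a common length.\<close>
  have pad: "comb v n t" if "comb v m t" "m \<le> n" for v m n t
  proof -
    have supp: "j < m" if "t j \<noteq> 0" for j
      using that \<open>comb v m t\<close> by (auto simp: comb_def simp flip: not_le)
    have "(\<Sum>j<n. t j *\<^sub>R y j) = (\<Sum>j<m. t j *\<^sub>R y j)" "(\<Sum>j<n. t j) = (\<Sum>j<m. t j)"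
      using \<open>m \<le> n\<close> by (auto intro!: sum.mono_neutral_right intro: supp)
    then show ?thesis
      using that by (simp add: comb_def)
  qed
  have "convex C"
  proof (rule convexI)
    fix v w and a b :: real
    assume vw: "v \<in> C" "w \<in> C" and ab: "0 \<le> a" "0 \<le> b" "a + b = 1"
    obtain m s where s: "comb v m s"
      using vw(1) unfolding C_def by blast
    obtain n t where t: "comb w n t"
      using vw(2) unfolding C_def by blast
    define N where "N = max m n"
    have st: "comb v N s" "comb w N t"
      using pad s t by (simp_all add: N_def)
    have "a *\<^sub>R v + b *\<^sub>R w = (\<Sum>j<N. (a * s j + b * t j) *\<^sub>R y j)"
      using st by (simp add: comb_def sum.distrib scaleR_sum_right scaleR_add_left)
    moreover have "(\<Sum>j<N. a * s j + b * t j) = 1"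
      using st ab by (simp add: comb_def sum.distrib flip: sum_distrib_left)
    ultimately have "comb (a *\<^sub>R v + b *\<^sub>R w) N (\<lambda>j. a * s j + b * t j)"
      using st ab by (simp add: comb_def)
    then show "a *\<^sub>R v + b *\<^sub>R w \<in> C"
      unfolding C_def by blast
  qed
  moreover have "c \<le> norm v" if v: "v \<in> C" for v
  proof -
    obtain m t where "comb v m t"
      using v unfolding C_def by blast
    then show ?thesis
      using ge[of t m] by (simp add: comb_def)
  qed
  ultimately obtain g where g: "linear g" "\<And>x. \<bar>g x\<bar> \<le> norm x" "\<And>v. v \<in> C \<Longrightarrow> c \<le> g v"
    using convex_separation_from_ball by blast
  have "comb (y j) (Suc j) (\<lambda>k. if k = j then 1 else 0)" for j
    by (simp add: comb_def if_distrib[of "\<lambda>a. a *\<^sub>R _"] cong: if_cong)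
  then have "y j \<in> C" for j
    unfolding C_def by blast
  then show ?thesis
    using that g by blast
qed

section \<open>The oscillation of a sequence and of its images under functionals\<close>

lemma bounded_tail: "bounded (range x) \<Longrightarrow> bounded {x k |k. k \<ge> (n::nat)}"
  by (erule bounded_subset) auto

lemma ca_nonneg: "bounded (range x) \<Longrightarrow> 0 \<le> ca x"
  unfolding ca_def by (intro cINF_greatest diameter_ge_0 bounded_tail) auto

lemma ca_le_diameter: "bounded (range x) \<Longrightarrow> ca x \<le> diameter {x k |k. k \<ge> n}"
  unfolding ca_def
  by (rule cINF_lower[OF bdd_belowI2[of _ 0]]) (auto intro: diameter_ge_0 bounded_tail)

lemma ca_geI:
  assumes "bounded (range x)" and "\<And>N. \<exists>m\<ge>N. \<exists>n\<ge>N. c \<le> dist (x m) (x n)"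
  shows "c \<le> ca x"
  unfolding ca_def
proof (rule cINF_greatest)
  fix N
  obtain m n where mn: "m \<ge> N" "n \<ge> N" "c \<le> dist (x m) (x n)"
    using assms(2) by blast
  have "dist (x m) (x n) \<le> diameter {x k |k. k \<ge> N}"
    by (rule diameter_bounded_bound[OF bounded_tail[OF assms(1)]]) (use mn in auto)
  with mn(3) show "c \<le> diameter {x k |k. k \<ge> N}"
    by simp
qed simp

lemma ca_less_pairs:
  assumes "bounded (range x)" and "0 < c" and "c < ca x"
  obtains p q where "\<And>N. N \<le> p N" "\<And>N. N \<le> q N" "\<And>N. c < dist (x (p N)) (x (q N))"
proof -
  have "\<exists>m\<ge>N. \<exists>n\<ge>N. c < dist (x m) (x n)" for N
  proof -
    have "c < diameter {x k |k. k \<ge> N}"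
      using assms(3) ca_le_diameter[OF assms(1)] by (rule less_le_trans)
    from diameter_lower_bounded[OF bounded_tail[OF assms(1)] assms(2) this]
    show ?thesis by auto
  qed
  then show ?thesis
    using that by metis
qed

context banach_space_over
begin

lemma dual_unit_ball_norm_le:
  assumes "f \<in> dual_unit_ball smul"
  shows "norm (f x) \<le> norm x"
proof -
  have f: "bounded_linear f" "onorm f \<le> 1"
    using assms by (simp_all add: dual_unit_ball_def)
  have "norm (f x) \<le> onorm f * norm x"
    using f(1) by (rule onorm)
  also have "\<dots> \<le> 1 * norm x"
    using f(2) by (rule mult_right_mono) simp
  finally show ?thesis by simp
qed

lemma dual_unit_ball_bounded_range:
  assumes "f \<in> dual_unit_ball smul" and "bounded (range x)"
  shows "bounded (range (\<lambda>n. f (x n)))"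
proof -
  obtain B where "\<And>n. norm (x n) \<le> B"
    using assms(2) by (auto simp: bounded_iff)
  then have "norm (f (x n)) \<le> B" for n
    using dual_unit_ball_norm_le[OF assms(1)] order_trans by blast
  then show ?thesis
    by (auto simp: bounded_iff)
qed

lemma ca_le_weak_ca:
  assumes f: "f \<in> dual_unit_ball smul" and x: "bounded (range x)"
  shows "ca (\<lambda>n. f (x n)) \<le> weak_ca smul x"
  unfolding weak_ca_def
proof (rule cSUP_upper[OF f])
  obtain B where B: "\<And>n. norm (x n) \<le> B"
    using x by (auto simp: bounded_iff)
  show "bdd_above ((\<lambda>f. ca (\<lambda>n. f (x n))) ` dual_unit_ball smul)"
  proof (rule bdd_aboveI2)
    fix f
    assume f: "f \<in> dual_unit_ball smul"
    have "ca (\<lambda>n. f (x n)) \<le> diameter {f (x k) |k. k \<ge> 0}"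
      by (intro ca_le_diameter dual_unit_ball_bounded_range f x)
    also have "\<dots> \<le> 2 * B"
    proof (rule diameter_le)
      fix v w
      assume "v \<in> {f (x k) |k. k \<ge> 0}" "w \<in> {f (x k) |k. k \<ge> 0}"
      then have "norm v \<le> B" "norm w \<le> B"
        using B dual_unit_ball_norm_le[OF f] by (auto intro: order_trans)
      then show "norm (v - w) \<le> 2 * B"
        using norm_triangle_ineq4[of v w] by linarith
    qed auto
    finally show "ca (\<lambda>n. f (x n)) \<le> 2 * B" .
  qed
qed

section \<open>The Schur properties\<close>

text \<open>
  For nonnegative weights with sum 1 the estimate of linear combinations reads
  \<open>\<parallel>\<Sum> t\<^sub>j d\<^sub>j\<parallel> \<ge> \<parallel>l\<parallel> + \<rho> - \<eta>\<close>, and \<open>\<eta>\<close> is chosen to make the right-hand side \<open>c\<close>.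
\<close>
lemma dual_functional_large_on_subseq:
  assumes z: "\<And>u. (\<lambda>n. norm (d n - l + u)) \<longlonglongrightarrow> norm u + \<rho>" and c: "c < norm l + \<rho>"
  obtains f r where "f \<in> dual_unit_ball smul" "strict_mono (r :: nat \<Rightarrow> nat)" "\<And>j. c \<le> norm (f (d (r j)))"
proof -
  define \<eta> where "\<eta> = norm l + \<rho> - c"
  have "0 < \<eta>"
    using c by (simp add: \<eta>_def)
  from subseq_norm_sum_ge[OF z this] obtain r where r: "strict_mono (r :: nat \<Rightarrow> nat)"
    and ge: "\<And>m \<alpha>. norm (\<Sum>j<m. \<alpha> j) * norm l + (\<rho> - \<eta>) * (\<Sum>j<m. norm (\<alpha> j))
      \<le> norm (\<Sum>j<m. smul (\<alpha> j) (d (r j)))" by blast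
  have "c \<le> norm (\<Sum>j<m. t j *\<^sub>R d (r j))" if t: "\<And>j. 0 \<le> t j" "(\<Sum>j<m. t j) = 1" for m and t :: "nat \<Rightarrow> real"
  proof -
    have "(\<Sum>j<m. of_real (t j) :: 'k) = 1"
      using t(2) by (simp flip: of_real_sum)
    then show ?thesis
      using ge[where m = m and \<alpha> = "\<lambda>j. of_real (t j)"] t by (simp add: smul_of_real \<eta>_def)
  qed
  then obtain g where g: "linear g" "\<And>x. \<bar>g x\<bar> \<le> norm x" "\<And>j. c \<le> g (d (r j))"
    using functional_bounded_below_on_sequence[where y = "\<lambda>j. d (r j)"] by blast
  obtain f where f: "f \<in> dual_unit_ball smul" "\<And>x. \<bar>g x\<bar> \<le> norm (f x)"
    using dual_functional_dominating_real[OF g(1,2)] by blast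
  have "c \<le> norm (f (d (r j)))" for j
    using g(3)[of j] f(2)[of "d (r j)"] by linarith
  then show ?thesis
    using that f(1) r by blast
qed

lemma one_Schur_if_subseq_asymptotically_additive:
  assumes ext: "\<And>x :: nat \<Rightarrow> 'a. bounded (range x) \<Longrightarrow> \<exists>r l \<rho>. strict_mono (r :: nat \<Rightarrow> nat) \<and>
      (\<forall>u. (\<lambda>n. norm (x (r n) - l + u)) \<longlonglongrightarrow> norm u + \<rho>)"
  shows "one_Schur smul"
  unfolding one_Schur_def
proof (intro allI impI)
  fix x :: "nat \<Rightarrow> 'a"
  assume x: "bounded (range x)"
  show "ca x \<le> weak_ca smul x"
  proof (rule dense_le)
    fix c
    assume "c < ca x"
    show "c \<le> weak_ca smul x"
    proof (cases "0 < c")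
      case False
      have "(\<lambda>_. 0) \<in> dual_unit_ball smul"
        by (rule dual_unit_ballI) auto
      from ca_le_weak_ca[OF this x] ca_nonneg[OF dual_unit_ball_bounded_range[OF this x]] False
      show ?thesis by linarith
    next
      case True
      obtain c' where c': "c < c'" "c' < ca x"
        using \<open>c < ca x\<close> dense by blast
      obtain p q where p: "\<And>N. N \<le> p N" and q: "\<And>N. N \<le> q N"
        and pq: "\<And>N. c' < dist (x (p N)) (x (q N))"
        using ca_less_pairs[OF x _ c'(2)] True c'(1) by auto
      define d where "d N = x (p N) - x (q N)" for N
      have "bounded ((\<lambda>(a, b). a - b) ` (range x \<times> range x))"
        using bounded_minus_comp[of fst "range x \<times> range x" snd] x
        by (simp add: case_prod_unfold bounded_fst bounded_snd)
      then have "bounded (range d)"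
        by (rule bounded_subset) (auto simp: d_def)
      then obtain r l \<rho> where r: "strict_mono (r :: nat \<Rightarrow> nat)"
        and lim: "\<And>u. (\<lambda>n. norm (d (r n) - l + u)) \<longlonglongrightarrow> norm u + \<rho>"
        using ext by blast
      \<comment> \<open>The choice \<open>u = l\<close> gives the limit of the norms of the differences themselves.\<close>
      have "c' \<le> norm l + \<rho>"
      proof (rule LIMSEQ_le_const)
        show "(\<lambda>n. norm (d (r n))) \<longlonglongrightarrow> norm l + \<rho>"
          using lim[of l] by simp
        show "\<exists>N. \<forall>n\<ge>N. c' \<le> norm (d (r n))"
          using pq by (auto simp: d_def dist_norm intro: less_imp_le)
      qed
      then have "c < norm l + \<rho>"
        using c' by simp
      from dual_functional_large_on_subseq[OF lim this]
      obtain f s where f: "f \<in> dual_unit_ball smul" and s: "strict_mono (s :: nat \<Rightarrow> nat)"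
        and ge: "\<And>j. c \<le> norm (f (d (r (s j))))" by blast
      have diff: "f (a - b) = f a - f b" for a b
        using f by (auto simp: dual_unit_ball_def intro: linear_diff bounded_linear.linear)
      have "c \<le> ca (\<lambda>n. f (x n))"
      proof (rule ca_geI[OF dual_unit_ball_bounded_range[OF f x]])
        fix N
        have "N \<le> r (s N)"
          using seq_suble[OF r, of "s N"] seq_suble[OF s, of N] by simp
        then show "\<exists>m\<ge>N. \<exists>n\<ge>N. c \<le> dist (f (x m)) (f (x n))"
          using p[of "r (s N)"] q[of "r (s N)"] ge[of N]
          by (intro exI[of _ "p (r (s N))"] exI[of _ "q (r (s N))"] conjI)
            (auto simp: d_def dist_norm diff)
      qed
      also have "\<dots> \<le> weak_ca smul x"
        by (rule ca_le_weak_ca[OF f x])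
      finally show ?thesis .
    qed
  qed
qed

lemma one_strong_Schur_if_subseq_asymptotically_additive:
  assumes ext: "\<And>x :: nat \<Rightarrow> 'a. bounded (range x) \<Longrightarrow> \<exists>r l \<rho>. strict_mono (r :: nat \<Rightarrow> nat) \<and>
      (\<forall>u. (\<lambda>n. norm (x (r n) - l + u)) \<longlonglongrightarrow> norm u + \<rho>)"
  shows "one_strong_Schur smul"
  unfolding one_strong_Schur_def
proof (intro allI impI, elim conjE)
  fix \<delta> \<epsilon> :: real and x :: "nat \<Rightarrow> 'a"
  assume \<delta>: "0 < \<delta>" and \<epsilon>: "0 < \<epsilon>" and unit: "\<forall>n. norm (x n) = 1"
    and sep: "\<forall>n m. n \<noteq> m \<longrightarrow> \<delta> \<le> norm (x n - x m)"
  have "bounded (range x)"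
    using unit by (auto simp: bounded_iff)
  then obtain r l \<rho> where r: "strict_mono (r :: nat \<Rightarrow> nat)"
    and lim: "\<And>u. (\<lambda>n. norm (x (r n) - l + u)) \<longlonglongrightarrow> norm u + \<rho>"
    using ext by blast
  \<comment> \<open>First \<open>m\<close> tends to infinity in \<open>\<delta> \<le> \<parallel>x (r m) - x (r n)\<parallel>\<close>, then \<open>n\<close>.\<close>
  have "\<delta> \<le> norm (l - x (r n)) + \<rho>" for n
  proof (rule LIMSEQ_le_const)
    show "(\<lambda>m. norm (x (r m) - x (r n))) \<longlonglongrightarrow> norm (l - x (r n)) + \<rho>"
      using lim[of "l - x (r n)"] by simp
    show "\<exists>N. \<forall>m\<ge>N. \<delta> \<le> norm (x (r m) - x (r n))"
    proof (intro exI allI impI)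
      fix m
      assume "Suc n \<le> m"
      then have "r m \<noteq> r n"
        using strict_monoD[OF r, of n m] by simp
      then show "\<delta> \<le> norm (x (r m) - x (r n))"
        using sep by blast
    qed
  qed
  moreover have "(\<lambda>n. norm (l - x (r n)) + \<rho>) \<longlonglongrightarrow> \<rho> + \<rho>"
    using lim[of 0] by (intro tendsto_intros) (simp add: norm_minus_commute)
  ultimately have "\<delta> \<le> \<rho> + \<rho>"
    by (intro LIMSEQ_le_const) auto
  define K where "K = 2 / \<delta> + \<epsilon>"
  have K: "0 < K" "2 / \<delta> < K"
    using \<delta> \<epsilon> by (simp_all add: K_def add_pos_pos)
  then have "1 / K < \<delta> / 2"
    using \<delta> by (simp add: pos_divide_less_eq mult.commute)
  then have "0 < \<rho> - 1 / K"
    using \<open>\<delta> \<le> \<rho> + \<rho>\<close> by linarith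
  \<comment> \<open>With the error \<open>\<rho> - 1 / K\<close> the coefficient of the \<open>\<ell>\<^sub>1\<close> norm becomes exactly \<open>1 / K\<close>.\<close>
  from subseq_norm_sum_ge[OF lim this] obtain s where s: "strict_mono (s :: nat \<Rightarrow> nat)"
    and ge: "\<And>m \<alpha>. norm (\<Sum>j<m. \<alpha> j) * norm l + (\<rho> - (\<rho> - 1 / K)) * (\<Sum>j<m. norm (\<alpha> j))
      \<le> norm (\<Sum>j<m. smul (\<alpha> j) (x (r (s j))))" by blast
  have "1 / K * (\<Sum>j<m. norm (\<alpha> j)) \<le> norm (\<Sum>j<m. smul (\<alpha> j) ((x \<circ> (r \<circ> s)) j))" for m \<alpha>
  proof -
    have "0 \<le> norm (\<Sum>j<m. \<alpha> j) * norm l"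
      by simp
    moreover have "norm (\<Sum>j<m. \<alpha> j) * norm l + 1 / K * (\<Sum>j<m. norm (\<alpha> j))
        \<le> norm (\<Sum>j<m. smul (\<alpha> j) ((x \<circ> (r \<circ> s)) j))"
      using ge[where m = m and \<alpha> = \<alpha>] by simp
    ultimately show ?thesis by linarith
  qed
  then have "equiv_l1_basis smul K (x \<circ> (r \<circ> s))"
    using unit by (auto simp: equiv_l1_basis_def)
  then show "\<exists>r. strict_mono (r :: nat \<Rightarrow> nat) \<and> equiv_l1_basis smul (2 / \<delta> + \<epsilon>) (x \<circ> r)"
    using strict_mono_o[OF r s] unfolding K_def by blast
qed

end

theorem theorem6p5:
  fixes smul :: "'k::real_or_complex \<Rightarrow> 'a::banach \<Rightarrow> 'a"
    and \<tau> :: "'a topology"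
  assumes "banach_space_over smul"
    and "linear_topology smul \<tau>"
    and "\<And>x :: nat \<Rightarrow> 'a. bounded (range x) \<Longrightarrow>
           \<exists>r l. strict_mono (r :: nat \<Rightarrow> nat) \<and> limitin \<tau> (x \<circ> r) l sequentially"
    and "\<And>(x :: nat \<Rightarrow> 'a) y. bounded (range x) \<Longrightarrow> limitin \<tau> x 0 sequentially \<Longrightarrow>
           limsup (\<lambda>n. ereal (norm (x n + y))) = ereal (norm y) + limsup (\<lambda>n. ereal (norm (x n)))"
  shows "one_Schur smul \<and> one_strong_Schur smul"
proof -
  interpret banach_space_over smul
    by (rule assms(1))
  have "\<exists>r l \<rho>. strict_mono (r :: nat \<Rightarrow> nat) \<and>
      (\<forall>u. (\<lambda>n. norm (x (r n) - l + u)) \<longlonglongrightarrow> norm u + \<rho>)"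
    if "bounded (range x)" for x :: "nat \<Rightarrow> 'a"
    using subseq_asymptotically_additive[OF assms(2-4) that] by metis
  then show ?thesis
    using one_Schur_if_subseq_asymptotically_additive
      one_strong_Schur_if_subseq_asymptotically_additive by blast
qed

end
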